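(* Let $p:\mathbb{R}^n\to\mathbb{R}$ be a nonnegative convex SPQ polynomial. Then $p$ can be written as the sum of a nonnegative separable polynomial and a nonnegative quadratic polynomial.
   Context: All polynomials have real coefficients. A polynomial $p:\mathbb{R}^n\to\mathbb{R}$ is separable if $p(x)=\sum_{i=1}^n s_i(x_i)$ for some univariate polynomials $s_i$. It is separable plus quadratic (SPQ) if it is the sum of a separable polynomial and a quadratic polynomial, where a quadratic polynomial is a polynomial of degree at most $2$ (not necessarily homogeneous). It is nonnegative if $p(x)\ge 0$ for all $x\in\mathbb{R}^n$. *)

theory Defs
  imports "HOL-Analysis.Analysis" "HOL-Computational_Algebra.Polynomial"
begin

text \<open>Polynomials in \<open>n\<close> real variables are represented by the functions on \<open>\<real>\<^sup>n\<close> they induce, the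
  variables being indexed by the finite type \<open>'n\<close>; an exponent vector is a function
  \<open>\<alpha> :: 'n \<Rightarrow> nat\<close>. Since \<open>\<real>\<close> is infinite, such a function determines the polynomial.\<close>

definition polynomial_of_degree_le :: "nat \<Rightarrow> (real ^ 'n \<Rightarrow> real) \<Rightarrow> bool" where
  "polynomial_of_degree_le d p \<longleftrightarrow>
     (\<exists>c :: ('n \<Rightarrow> nat) \<Rightarrow> real. \<forall>x.
        p x = (\<Sum>\<alpha> | (\<Sum>i\<in>UNIV. \<alpha> i) \<le> d. c \<alpha> * (\<Prod>i\<in>UNIV. (x $ i) ^ \<alpha> i)))"

text \<open>The sum above ranges over a finite set, so it is a genuine sum of monomials.\<close>

lemma finite_exponents_le: "finite {\<alpha> :: 'n::finite \<Rightarrow> nat. (\<Sum>i\<in>UNIV. \<alpha> i) \<le> d}"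
proof (rule finite_subset)
  show "{\<alpha> :: 'n \<Rightarrow> nat. (\<Sum>i\<in>UNIV. \<alpha> i) \<le> d} \<subseteq> PiE UNIV (\<lambda>_. {..d})"
  proof
    fix \<alpha> :: "'n \<Rightarrow> nat"
    assume "\<alpha> \<in> {\<alpha>. (\<Sum>i\<in>UNIV. \<alpha> i) \<le> d}"
    moreover have "\<alpha> j \<le> (\<Sum>i\<in>UNIV. \<alpha> i)" for j
      by (rule member_le_sum) auto
    ultimately show "\<alpha> \<in> PiE UNIV (\<lambda>_. {..d})"
      by (auto intro: order_trans)
  qed
  show "finite (PiE (UNIV :: 'n set) (\<lambda>_. {..d}))"
    by (rule finite_PiE) auto
qed

definition quadratic_polynomial :: "(real ^ 'n \<Rightarrow> real) \<Rightarrow> bool" where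
  "quadratic_polynomial p \<longleftrightarrow> polynomial_of_degree_le 2 p"

definition separable_polynomial :: "(real ^ 'n \<Rightarrow> real) \<Rightarrow> bool" where
  "separable_polynomial p \<longleftrightarrow>
     (\<exists>s :: 'n \<Rightarrow> real poly. \<forall>x. p x = (\<Sum>i\<in>UNIV. poly (s i) (x $ i)))"

definition SPQ_polynomial :: "(real ^ 'n \<Rightarrow> real) \<Rightarrow> bool" where
  "SPQ_polynomial p \<longleftrightarrow>
     (\<exists>s q. separable_polynomial s \<and> quadratic_polynomial q \<and> (\<forall>x. p x = s x + q x))"

definition nonnegative_polynomial :: "(real ^ 'n \<Rightarrow> real) \<Rightarrow> bool" where
  "nonnegative_polynomial p \<longleftrightarrow> (\<forall>x. 0 \<le> p x)"

end

theory Submission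
  imports Defs
begin

text \<open>
  Write \<open>p = \<Sum>i. s\<^sub>i(x\<^sub>i) + q\<close> and let \<open>m\<^sub>i\<close> be the infimum of \<open>s\<^sub>i''\<close>, which is finite by
  convexity of \<open>p\<close>. Because the coordinates vary independently, positive semidefiniteness of the
  Hessian of \<open>p\<close> everywhere means that of \<open>\<nabla>\<^sup>2 q + diag(m)\<close>; hence moving
  \<open>\<Sum>i. m\<^sub>i x\<^sub>i\<^sup>2 / 2\<close> from the separable to the quadratic part makes both parts convex. Since their
  sum \<open>S + Q\<close> is nonnegative, the convex \<open>S\<close> lies above the concave \<open>-Q\<close>, and a hyperplane
  separating the strict epigraph of \<open>S\<close> from the hypograph of \<open>-Q\<close> is the graph of an affine
  function \<open>l\<close> with \<open>S \<ge> l \<ge> -Q\<close>. The summands \<open>S - l\<close> and \<open>Q + l\<close> are as required.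
\<close>

section \<open>Affine separation of convex functions\<close>

lemma convex_strict_epigraph_UNIV:
  assumes "convex_on UNIV f"
  shows "convex {(x, t). f x < (t::real)}"
proof (rule convexI, clarsimp)
  fix x y :: 'a and r t u v :: real
  assume a: "f x < r" "f y < t" "0 \<le> u" "0 \<le> v" "u + v = 1"
  have "f (u *\<^sub>R x + v *\<^sub>R y) \<le> u * f x + v * f y"
    using assms a by (auto simp: convex_on_def)
  also have "\<dots> < u * r + v * t"
  \<comment> \<open>Strictness comes from the \<open>u\<close>-weighted term; if
    \<open>u = 0\<close>, then \<open>v = 1\<close> and the other point supplies it.\<close>
  proof (cases "u = 0")
    case False
    then have "u * f x < u * r" using a by simp
    moreover have "v * f y \<le> v * t" using a by (simp add: mult_left_mono)
    ultimately show ?thesis by simp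
  qed (use a in auto)
  finally show "f (u *\<^sub>R x + v *\<^sub>R y) < u * r + v * t" .
qed

lemma convex_hypograph_uminus_UNIV:
  assumes "convex_on UNIV g"
  shows "convex {(x, t). (t::real) \<le> - g x}"
proof (rule convexI, clarsimp)
  fix x y :: 'a and r t u v :: real
  assume a: "r \<le> - g x" "t \<le> - g y" "0 \<le> u" "0 \<le> v" "u + v = 1"
  have "g (u *\<^sub>R x + v *\<^sub>R y) \<le> u * g x + v * g y"
    using assms a by (auto simp: convex_on_def)
  also have "\<dots> \<le> u * (- r) + v * (- t)"
    using a by (intro add_mono mult_left_mono) auto
  finally show "u * r + v * t \<le> - g (u *\<^sub>R x + v *\<^sub>R y)" by simp
qed

text \<open>The strict epigraph of \<open>f\<close> and the hypograph of \<open>- g\<close> are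
  disjoint convex sets. Both project onto the whole space, so a separating hyperplane is not
  vertical and is the graph of an affine function.\<close>

lemma convex_on_affine_sandwich:
  fixes f g :: "'a::euclidean_space \<Rightarrow> real"
  assumes f: "convex_on UNIV f" and g: "convex_on UNIV g"
    and nonneg: "\<And>x. 0 \<le> f x + g x"
  obtains a c where "\<And>x. a \<bullet> x + c \<le> f x" "\<And>x. 0 \<le> g x + (a \<bullet> x + c)"
proof -
  let ?E = "{(x, t). f x < t}" and ?H = "{(x, t). t \<le> - g x}"
  have "(0, f 0 + 1) \<in> ?E" "(0, - g 0) \<in> ?H" by auto
  then have "?E \<noteq> {}" "?H \<noteq> {}" by blast+
  moreover have "?H \<inter> ?E = {}"
  proof -
    have "\<not> (t \<le> - g x \<and> f x < t)" for x t using nonneg[of x] by linarith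
    then show ?thesis by auto
  qed
  ultimately obtain n b where n: "n \<noteq> 0"
    and H: "\<forall>z\<in>?H. n \<bullet> z \<le> b" and E: "\<forall>z\<in>?E. b \<le> n \<bullet> z"
    using separating_hyperplane_sets[OF convex_hypograph_uminus_UNIV[OF g]
        convex_strict_epigraph_UNIV[OF f]] by blast
  obtain d k where dk: "n = (d, k)" by fastforce
  have H': "d \<bullet> x + k * t \<le> b" if "t \<le> - g x" for x t
    using H that by (auto simp: dk)
  have E': "b \<le> d \<bullet> x + k * t" if "f x < t" for x t
    using E that by (auto simp: dk)
  \<comment> \<open>If \<open>k = 0\<close>, the two bounds make \<open>d \<bullet> x\<close>
    constantly \<open>b\<close>, which forces the normal \<open>n\<close> to vanish.\<close>
  have "k \<noteq> 0"
  proof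
    assume k: "k = 0"
    then have "d \<bullet> x = b" for x
      using H'[of "- g x" x] E'[of x "f x + 1"] by simp
    from this[of 0] this[of d] have "d = 0" by simp
    with k n dk show False by (simp add: zero_prod_def)
  qed
  \<comment> \<open>Over the origin, the chosen point of the epigraph lies strictly above that of
    the hypograph.\<close>
  moreover have "0 \<le> k"
  proof -
    have "k * (- g 0) \<le> k * (f 0 + 1)"
      using H'[of "- g 0" 0] E'[of 0 "f 0 + 1"] by simp
    then have "0 \<le> k * (f 0 + g 0 + 1)" by (simp add: algebra_simps)
    moreover have "0 < f 0 + g 0 + 1" using nonneg[of 0] by linarith
    ultimately show ?thesis by (simp add: zero_le_mult_iff)
  qed
  ultimately have k: "0 < k" by simp
  show ?thesis
  \<comment> \<open>The affine function comes from solving \<open>d \<bullet> x + k * t = b\<close>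
    for \<open>t\<close>.\<close>
  proof (rule that[of "- (1 / k) *\<^sub>R d" "b / k"])
    fix x
    have "b / k - (d \<bullet> x) / k \<le> t" if "f x < t" for t
      using E'[OF that] k by (simp add: field_simps)
    \<comment> \<open>The strict epigraph bounds only heights above \<open>f x\<close>; density lets
      \<open>t\<close> decrease to \<open>f x\<close>.\<close>
    then have "b / k - (d \<bullet> x) / k \<le> f x" by (rule dense_ge)
    then show "- (1 / k) *\<^sub>R d \<bullet> x + b / k \<le> f x" by simp
    have "0 \<le> g x + (b / k - (d \<bullet> x) / k)"
      using H'[of "- g x" x] k by (simp add: field_simps)
    then show "0 \<le> g x + (- (1 / k) *\<^sub>R d \<bullet> x + b / k)" by simp
  qed
qed

section \<open>Convexity of polynomials\<close>

text \<open>For the forward direction, a convex graph lies above its tangents, and this makes the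
  derivative monotone.\<close>

lemma convex_on_poly_iff:
  fixes s :: "real poly"
  shows "convex_on UNIV (poly s) \<longleftrightarrow> (\<forall>x. 0 \<le> poly (pderiv (pderiv s)) x)"
proof
  assume cv: "convex_on UNIV (poly s)"
  have tangent: "poly (pderiv s) x * (y - x) \<le> poly s y - poly s x" for x y
    by (rule convex_on_imp_above_tangent[OF cv]) auto
  have "mono (poly (pderiv s))"
  proof (rule monoI)
    fix x y :: real
    assume "x \<le> y"
    show "poly (pderiv s) x \<le> poly (pderiv s) y"
    proof (cases "x = y")
      case False
      with \<open>x \<le> y\<close> have "0 < y - x" by simp
      \<comment> \<open>The tangent inequalities at \<open>x\<close> and at \<open>y\<close> are
        added.\<close>
      moreover have "poly (pderiv s) x * (y - x) \<le> poly (pderiv s) y * (y - x)"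
        using tangent[of x y] tangent[of y x] by (simp add: algebra_simps)
      ultimately show ?thesis by simp
    qed simp
  qed
  then show "\<forall>x. 0 \<le> poly (pderiv (pderiv s)) x"
    by (auto intro: mono_on_imp_deriv_nonneg[OF _ poly_DERIV, where A = UNIV])
next
  assume "\<forall>x. 0 \<le> poly (pderiv (pderiv s)) x"
  then show "convex_on UNIV (poly s)"
    by (intro f''_ge0_imp_convex[where f' = "poly (pderiv s)"
        and f'' = "poly (pderiv (pderiv s))"]) auto
qed

lemma pderiv_sum:
  fixes f :: "'a \<Rightarrow> 'b::{comm_semiring_1,semiring_no_zero_divisors} poly"
  shows "pderiv (\<Sum>i\<in>A. f i) = (\<Sum>i\<in>A. pderiv (f i))"
  by (induction A rule: infinite_finite_induct) (simp_all add: pderiv_add)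

lemma convex_on_separable_sum:
  fixes f :: "'n::finite \<Rightarrow> real \<Rightarrow> real"
  assumes "\<And>i. convex_on UNIV (f i)"
  shows "convex_on UNIV (\<lambda>x :: real ^ 'n. \<Sum>i\<in>UNIV. f i (x $ i))"
proof (rule convex_onI)
  fix t :: real and x y :: "real ^ 'n"
  assume "0 < t" "t < 1"
  then have "(\<Sum>i\<in>UNIV. f i (((1 - t) *\<^sub>R x + t *\<^sub>R y) $ i))
      \<le> (\<Sum>i\<in>UNIV. (1 - t) * f i (x $ i) + t * f i (y $ i))"
    using convex_onD[OF assms, of t] by (intro sum_mono) auto
  then show "(\<Sum>i\<in>UNIV. f i (((1 - t) *\<^sub>R x + t *\<^sub>R y) $ i))
      \<le> (1 - t) * (\<Sum>i\<in>UNIV. f i (x $ i)) + t * (\<Sum>i\<in>UNIV. f i (y $ i))"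
    by (simp add: sum.distrib sum_distrib_left)
qed simp

text \<open>On a segment both sides of the convexity inequality share their constant and linear
  terms; what remains is \<open>t\<^sup>2 \<le> t\<close> with a nonnegative weight.\<close>

lemma convex_on_quadratic_along_lines:
  fixes q :: "'a::real_vector \<Rightarrow> real"
  assumes line: "\<And>x v. \<exists>b. \<forall>t. q (x + t *\<^sub>R v) = q x + b * t + B v * t\<^sup>2"
    and B: "\<And>v. 0 \<le> B v"
  shows "convex_on UNIV q"
proof (rule convex_onI)
  fix t :: real and x y :: 'a
  assume t: "0 < t" "t < 1"
  obtain b where b: "\<And>u. q (x + u *\<^sub>R (y - x)) = q x + b * u + B (y - x) * u\<^sup>2"
    using line[of x "y - x"] by blast
  have "(1 - t) *\<^sub>R x + t *\<^sub>R y = x + t *\<^sub>R (y - x)" by (simp add: algebra_simps)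
  then have eq: "q ((1 - t) *\<^sub>R x + t *\<^sub>R y) = q x + b * t + B (y - x) * t\<^sup>2" by (simp add: b)
  have "t\<^sup>2 \<le> t" using t by (simp add: power2_eq_square)
  then have "B (y - x) * t\<^sup>2 \<le> B (y - x) * t" by (intro mult_left_mono B)
  moreover have "q y = q x + b + B (y - x)" using b[of 1] by simp
  ultimately show "q ((1 - t) *\<^sub>R x + t *\<^sub>R y) \<le> (1 - t) * q x + t * q y"
    unfolding eq by (simp add: algebra_simps)
qed simp

section \<open>Polynomials in several variables\<close>

lemma polynomial_of_degree_le_add:
  assumes "polynomial_of_degree_le d f" "polynomial_of_degree_le d g"
  shows "polynomial_of_degree_le d (\<lambda>x. f x + g x)"
proof -
  obtain c c' where
    "f x = (\<Sum>\<alpha> | (\<Sum>i\<in>UNIV. \<alpha> i) \<le> d. c \<alpha> * (\<Prod>i\<in>UNIV. (x $ i) ^ \<alpha> i))"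
    "g x = (\<Sum>\<alpha> | (\<Sum>i\<in>UNIV. \<alpha> i) \<le> d. c' \<alpha> * (\<Prod>i\<in>UNIV. (x $ i) ^ \<alpha> i))" for x
    using assms unfolding polynomial_of_degree_le_def by blast
  then show ?thesis unfolding polynomial_of_degree_le_def
    by (intro exI[of _ "\<lambda>\<alpha>. c \<alpha> + c' \<alpha>"]) (simp add: sum.distrib distrib_right)
qed

lemma polynomial_of_degree_le_monomial:
  fixes \<beta> :: "'n::finite \<Rightarrow> nat"
  assumes "(\<Sum>i\<in>UNIV. \<beta> i) \<le> d"
  shows "polynomial_of_degree_le d (\<lambda>x. a * (\<Prod>i\<in>UNIV. (x $ i) ^ \<beta> i))"
  unfolding polynomial_of_degree_le_def
proof (intro exI[of _ "\<lambda>\<alpha>. if \<alpha> = \<beta> then a else 0"] allI)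
  fix x :: "real ^ 'n"
  show "a * (\<Prod>i\<in>UNIV. (x $ i) ^ \<beta> i) = (\<Sum>\<alpha> | (\<Sum>i\<in>UNIV. \<alpha> i) \<le> d.
      (if \<alpha> = \<beta> then a else 0) * (\<Prod>i\<in>UNIV. (x $ i) ^ \<alpha> i))"
    using assms by (simp add: if_distrib[of "\<lambda>z. z * _"] finite_exponents_le cong: if_cong)
qed

lemma polynomial_of_degree_le_sum:
  fixes f :: "'a \<Rightarrow> real ^ 'n \<Rightarrow> real"
  assumes "\<And>j. j \<in> A \<Longrightarrow> polynomial_of_degree_le d (f j)"
  shows "polynomial_of_degree_le d (\<lambda>x. \<Sum>j\<in>A. f j x)"
  using assms
proof (induction A rule: infinite_finite_induct)
  case (insert j A)
  then show ?case by (simp add: polynomial_of_degree_le_add)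
\<comment> \<open>Empty sums, and by convention sums over infinite sets, are 0: a monomial with
  coefficient 0.\<close>
qed (use polynomial_of_degree_le_monomial[of "\<lambda>_. 0" d 0] in auto)

lemma polynomial_of_degree_le_separable:
  fixes r :: "'n::finite \<Rightarrow> real poly"
  assumes "\<And>i. degree (r i) \<le> d"
  shows "polynomial_of_degree_le d (\<lambda>x. \<Sum>i\<in>UNIV. poly (r i) (x $ i))"
proof (rule polynomial_of_degree_le_sum)
  fix i
  have "polynomial_of_degree_le d (\<lambda>x :: real ^ 'n. coeff (r i) k * (x $ i) ^ k)"
    if "k \<le> degree (r i)" for k
  proof -
    let ?\<beta> = "\<lambda>j. if j = i then k else 0"
    have "(\<Prod>j\<in>UNIV. (x $ j) ^ ?\<beta> j) = (x $ i) ^ k" for x :: "real ^ 'n"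
      by (simp add: if_distrib[of "\<lambda>m. _ ^ m"] cong: if_cong)
    then show ?thesis
      using polynomial_of_degree_le_monomial[of ?\<beta> d "coeff (r i) k"] that assms[of i] by simp
  qed
  then show "polynomial_of_degree_le d (\<lambda>x :: real ^ 'n. poly (r i) (x $ i))"
    unfolding poly_altdef by (intro polynomial_of_degree_le_sum) simp
qed

text \<open>Only the index \<open>m\<close> survives in the convolution. Since \<open>m\<close> and
  \<open>n\<close> are mere degree bounds, the top coefficients may vanish.\<close>

lemma degree_le_coeff_mult:
  assumes "degree p \<le> m" "degree q \<le> n"
  shows "degree (p * q) \<le> m + n \<and> coeff (p * q) (m + n) = coeff p m * coeff q n"
proof
  show "degree (p * q) \<le> m + n"
    using degree_mult_le[of p q] assms by linarith
  have "coeff p i * coeff q (m + n - i) = (if i = m then coeff p m * coeff q n else 0)" for i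
    using assms by (cases i m rule: linorder_cases) (auto simp: coeff_eq_0)
  then show "coeff (p * q) (m + n) = coeff p m * coeff q n"
    by (simp add: coeff_mult)
qed

lemma degree_le_coeff_prod:
  fixes P :: "'a \<Rightarrow> 'b::comm_semiring_1 poly"
  assumes "finite A" "\<And>i. i \<in> A \<Longrightarrow> degree (P i) \<le> d i"
  shows "degree (\<Prod>i\<in>A. P i) \<le> (\<Sum>i\<in>A. d i) \<and>
    coeff (\<Prod>i\<in>A. P i) (\<Sum>i\<in>A. d i) = (\<Prod>i\<in>A. coeff (P i) (d i))"
  using assms by (induction A rule: finite_induct) (auto simp: degree_le_coeff_mult)

text \<open>On a line, a monomial becomes a product of powers of factors linear in \<open>t\<close>,
  whose top coefficient involves only the slopes \<open>v $ i\<close>. Hence \<open>B\<close> can be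
  chosen before \<open>x\<close>.\<close>

lemma polynomial_of_degree_le_along_lines:
  fixes f :: "real ^ 'n \<Rightarrow> real"
  assumes "polynomial_of_degree_le d f"
  obtains B where "\<And>x v. \<exists>P. degree P \<le> d \<and> coeff P d = B v \<and> (\<forall>t. f (x + t *\<^sub>R v) = poly P t)"
proof -
  obtain c where c:
    "\<And>x. f x = (\<Sum>\<alpha> | (\<Sum>i\<in>UNIV. \<alpha> i) \<le> d. c \<alpha> * (\<Prod>i\<in>UNIV. (x $ i) ^ \<alpha> i))"
    using assms unfolding polynomial_of_degree_le_def by blast
  define M where "M = (\<lambda>(x :: real ^ 'n) v \<alpha>. \<Prod>i\<in>UNIV. [:x $ i, v $ i:] ^ \<alpha> i)"
  have M: "degree (M x v \<alpha>) \<le> (\<Sum>i\<in>UNIV. \<alpha> i) \<and>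
      coeff (M x v \<alpha>) (\<Sum>i\<in>UNIV. \<alpha> i) = (\<Prod>i\<in>UNIV. (v $ i) ^ \<alpha> i)" for x v \<alpha>
  proof -
    have "degree ([:x $ i, v $ i:] ^ \<alpha> i) \<le> \<alpha> i" for i
      using degree_power_le[of "[:x $ i, v $ i:]" "\<alpha> i"] by (auto split: if_splits)
    then show ?thesis
      using degree_le_coeff_prod[of UNIV "\<lambda>i. [:x $ i, v $ i:] ^ \<alpha> i" \<alpha>]
      by (simp add: M_def coeff_linear_poly_power)
  qed
  have Md: "coeff (M x v \<alpha>) d =
      (if (\<Sum>i\<in>UNIV. \<alpha> i) = d then \<Prod>i\<in>UNIV. (v $ i) ^ \<alpha> i else 0)"
    if "(\<Sum>i\<in>UNIV. \<alpha> i) \<le> d" for x v \<alpha>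
    using M[of x v \<alpha>] that by (auto intro: coeff_eq_0)
  show ?thesis
  proof (rule that, intro exI conjI allI)
    fix x v :: "real ^ 'n"
    let ?P = "\<Sum>\<alpha> | (\<Sum>i\<in>UNIV. \<alpha> i) \<le> d. smult (c \<alpha>) (M x v \<alpha>)"
    show "degree ?P \<le> d"
      using M by (intro degree_sum_le finite_exponents_le)
        (auto intro: order_trans[OF degree_smult_le] order_trans)
    \<comment> \<open>The right-hand side is free of \<open>x\<close> and fixes the witness for
      \<open>B\<close>: the homogeneous part of degree \<open>d\<close> of \<open>f\<close>,
      evaluated at \<open>v\<close>.\<close>
    show "coeff ?P d = (\<Sum>\<alpha> | (\<Sum>i\<in>UNIV. \<alpha> i) \<le> d.
        c \<alpha> * (if (\<Sum>i\<in>UNIV. \<alpha> i) = d then \<Prod>i\<in>UNIV. (v $ i) ^ \<alpha> i else 0))"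
      by (simp add: coeff_sum Md)
    show "f (x + t *\<^sub>R v) = poly ?P t" for t
      by (simp add: c poly_sum M_def poly_prod algebra_simps)
  qed
qed

text \<open>Here \<open>2 * B v\<close> is the Hessian form of \<open>q\<close> in direction
  \<open>v\<close>; its independence of \<open>x\<close> says that the Hessian is constant.\<close>

lemma quadratic_polynomial_along_lines:
  fixes q :: "real ^ 'n \<Rightarrow> real"
  assumes "quadratic_polynomial q"
  obtains B where "\<And>x v. \<exists>b. \<forall>t. q (x + t *\<^sub>R v) = q x + b * t + B v * t\<^sup>2"
proof -
  obtain B where B:
    "\<And>x v. \<exists>P. degree P \<le> 2 \<and> coeff P 2 = B v \<and> (\<forall>t. q (x + t *\<^sub>R v) = poly P t)"
    using polynomial_of_degree_le_along_lines assms unfolding quadratic_polynomial_def by blast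
  show ?thesis
  proof (rule that)
    fix x v :: "real ^ 'n"
    obtain P where P: "degree P \<le> 2" "coeff P 2 = B v" "\<And>t. q (x + t *\<^sub>R v) = poly P t"
      using B by blast
    have "poly P t = coeff P 0 + coeff P 1 * t + coeff P 2 * t\<^sup>2" for t
    proof -
      have "poly P t = (\<Sum>i\<le>2. coeff P i * t ^ i)"
        unfolding poly_altdef using P(1) by (intro sum.mono_neutral_left) (auto simp: coeff_eq_0)
      then show ?thesis by (simp add: numeral_2_eq_2)
    qed
    moreover have "q x = coeff P 0" using P(3)[of 0] by (simp add: poly_0_coeff_0)
    ultimately show "\<exists>b. \<forall>t. q (x + t *\<^sub>R v) = q x + b * t + B v * t\<^sup>2"
      using P by auto
  qed
qed

section \<open>The decomposition\<close>

text \<open>This is the Hessian form of the convex function at \<open>x\<close> in direction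
  \<open>v\<close>, obtained as a second derivative along a line.\<close>

lemma convex_SPQ_second_derivative_nonneg:
  fixes s :: "'n::finite \<Rightarrow> real poly" and q :: "real ^ 'n \<Rightarrow> real"
  assumes cv: "convex_on UNIV (\<lambda>x. (\<Sum>i\<in>UNIV. poly (s i) (x $ i)) + q x)"
    and line: "\<And>x v. \<exists>b. \<forall>t. q (x + t *\<^sub>R v) = q x + b * t + B v * t\<^sup>2"
  shows "0 \<le> (\<Sum>i\<in>UNIV. poly (pderiv (pderiv (s i))) (x $ i) * (v $ i)\<^sup>2) + 2 * B v"
proof -
  let ?p = "\<lambda>x. (\<Sum>i\<in>UNIV. poly (s i) (x $ i)) + q x"
  obtain b where b: "\<And>t. q (x + t *\<^sub>R v) = q x + b * t + B v * t\<^sup>2" using line by blast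
  \<comment> \<open>The restriction to the line is itself a univariate polynomial, so the univariate
    criterion applies.\<close>
  define G where "G = (\<Sum>i\<in>UNIV. pcompose (s i) [:x $ i, v $ i:]) + [:q x, b, B v:]"
  have G: "poly G t = ?p (x + t *\<^sub>R v)" for t
    by (simp add: G_def b poly_sum poly_pcompose algebra_simps power2_eq_square)
  have "convex_on UNIV (poly G)"
  proof (rule convex_onI)
    fix t a c :: real
    assume t: "0 < t" "t < 1"
    have "x + ((1 - t) *\<^sub>R a + t *\<^sub>R c) *\<^sub>R v = (1 - t) *\<^sub>R (x + a *\<^sub>R v) + t *\<^sub>R (x + c *\<^sub>R v)"
      by (simp add: algebra_simps)
    then show "poly G ((1 - t) *\<^sub>R a + t *\<^sub>R c) \<le> (1 - t) * poly G a + t * poly G c"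
      using convex_onD[OF cv, of t "x + a *\<^sub>R v" "x + c *\<^sub>R v"] t unfolding G by simp
  qed simp
  then have "0 \<le> poly (pderiv (pderiv G)) 0" by (simp add: convex_on_poly_iff)
  moreover have "pderiv (pderiv (pcompose (s i) [:x $ i, v $ i:])) =
      smult ((v $ i)\<^sup>2) (pcompose (pderiv (pderiv (s i))) [:x $ i, v $ i:])" for i
    by (simp add: pderiv_pcompose pderiv_smult pderiv_pCons power2_eq_square)
  then have "poly (pderiv (pderiv G)) 0 =
      (\<Sum>i\<in>UNIV. poly (pderiv (pderiv (s i))) (x $ i) * (v $ i)\<^sup>2) + 2 * B v"
    unfolding G_def pderiv_add pderiv_sum poly_add poly_sum
    by (simp add: poly_pcompose pderiv_pCons mult.commute)
  ultimately show ?thesis by simp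
qed

lemma convex_SPQ_diagonal_split:
  fixes s :: "'n::finite \<Rightarrow> real poly" and q :: "real ^ 'n \<Rightarrow> real"
  assumes cv: "convex_on UNIV (\<lambda>x. (\<Sum>i\<in>UNIV. poly (s i) (x $ i)) + q x)"
    and line: "\<And>x v. \<exists>b. \<forall>t. q (x + t *\<^sub>R v) = q x + b * t + B v * t\<^sup>2"
  obtains m where "\<And>i x. m i \<le> poly (pderiv (pderiv (s i))) x"
    and "\<And>v. 0 \<le> (\<Sum>i\<in>UNIV. m i * (v $ i)\<^sup>2) + 2 * B v"
proof -
  define D where "D i = poly (pderiv (pderiv (s i)))" for i
  define m where "m i = (INF x. D i x)" for i
  note hess = convex_SPQ_second_derivative_nonneg[OF cv line, folded D_def]
  \<comment> \<open>The direction of the \<open>i\<close>-th axis isolates \<open>D i\<close>, so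
    the infimum defining \<open>m i\<close> is a genuine one.\<close>
  have "- 2 * B (axis i 1) \<le> D i t" for i t
  proof -
    have "(\<Sum>j\<in>UNIV. D j ((\<chi> j. t) $ j) * (axis i 1 $ j)\<^sup>2) = D i t"
      by (simp add: axis_def if_distrib[of "\<lambda>z. z\<^sup>2"] if_distrib[of "\<lambda>z. _ * z"] cong: if_cong)
    then show ?thesis using hess[of "\<chi> j. t" "axis i 1"] by simp
  qed
  then have bdd: "bdd_below (range (D i))" for i by (intro bdd_belowI2)
  show ?thesis
  proof (rule that)
    show "m i \<le> poly (pderiv (pderiv (s i))) x" for i x
      unfolding m_def D_def[symmetric] by (intro cINF_lower bdd) simp
    fix v :: "real ^ 'n"
    let ?K = "(\<Sum>i\<in>UNIV. m i * (v $ i)\<^sup>2) + 2 * B v" and ?W = "\<Sum>i\<in>UNIV. (v $ i)\<^sup>2"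
    \<comment> \<open>The coordinates of a single point can be chosen independently, each bringing
      its \<open>D i\<close> within \<open>e\<close> of the infimum.\<close>
    have approx: "0 \<le> ?K + e * ?W" if e: "0 < e" for e
    proof -
      have "\<exists>t. D i t < m i + e" for i
        using e bdd[of i] cINF_less_iff[of UNIV "D i" "m i + e"] by (simp add: m_def)
      then obtain x where x: "\<And>i. D i (x i) < m i + e" by metis
      have "0 \<le> (\<Sum>i\<in>UNIV. D i (x i) * (v $ i)\<^sup>2) + 2 * B v"
        using hess[of "\<chi> i. x i" v] by simp
      also have "\<dots> \<le> (\<Sum>i\<in>UNIV. (m i + e) * (v $ i)\<^sup>2) + 2 * B v"
        using x by (intro add_right_mono sum_mono mult_right_mono) (auto intro: less_imp_le)
      finally show ?thesis by (simp add: algebra_simps sum.distrib sum_distrib_left)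
    qed
    have W: "0 \<le> ?W" by (simp add: sum_nonneg)
    show "0 \<le> ?K"
    proof (rule field_le_epsilon)
      fix e :: real
      assume e: "0 < e"
      \<comment> \<open>The added 1 keeps the denominator positive when
        \<open>v = 0\<close>.\<close>
      have "e / (?W + 1) * ?W \<le> e" using e W by (simp add: field_simps)
      then show "0 \<le> ?K + e" using approx[of "e / (?W + 1)"] e W by simp
    qed
  qed
qed

theorem theorem5p3:
  fixes p :: "real ^ 'n \<Rightarrow> real"
  assumes "SPQ_polynomial p"
    and "convex_on UNIV p"
    and "nonnegative_polynomial p"
  shows "\<exists>s q. separable_polynomial s \<and> nonnegative_polynomial s \<and>
               quadratic_polynomial q \<and> nonnegative_polynomial q \<and>
               (\<forall>x. p x = s x + q x)"
proof -
  obtain s q where q: "quadratic_polynomial q"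
    and p: "\<And>x. p x = (\<Sum>i\<in>UNIV. poly (s i) (x $ i)) + q x"
    using assms(1) unfolding SPQ_polynomial_def separable_polynomial_def by metis
  obtain B where line: "\<And>x v. \<exists>b. \<forall>t. q (x + t *\<^sub>R v) = q x + b * t + B v * t\<^sup>2"
    using quadratic_polynomial_along_lines[OF q] by blast
  have "convex_on UNIV (\<lambda>x. (\<Sum>i\<in>UNIV. poly (s i) (x $ i)) + q x)"
    using assms(2) by (simp flip: p)
  then obtain m where m: "\<And>i x. m i \<le> poly (pderiv (pderiv (s i))) x"
    and mB: "\<And>v. 0 \<le> (\<Sum>i\<in>UNIV. m i * (v $ i)\<^sup>2) + 2 * B v"
    using convex_SPQ_diagonal_split line by blast
  \<comment> \<open>The subtracted term has second derivative \<open>m i\<close>, the lower bound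
    for that of \<open>s i\<close>.\<close>
  define S where "S x = (\<Sum>i\<in>UNIV. poly (s i - [:0, 0, m i / 2:]) (x $ i))" for x :: "real ^ 'n"
  define Q where "Q x = q x + (\<Sum>i\<in>UNIV. m i / 2 * (x $ i)\<^sup>2)" for x
  have pSQ: "p x = S x + Q x" for x
    by (simp add: p S_def Q_def sum_subtractf power2_eq_square mult_ac)
  have S: "convex_on UNIV S"
    unfolding S_def
    by (rule convex_on_separable_sum, subst convex_on_poly_iff)
      (simp add: m pderiv_diff pderiv_pCons)
  have Q: "convex_on UNIV Q"
  proof (rule convex_on_quadratic_along_lines)
    fix x v :: "real ^ 'n"
    \<comment> \<open>The second-order coefficient of \<open>Q\<close> is half the form in
      \<open>mB\<close>.\<close>
    show "0 \<le> B v + (\<Sum>i\<in>UNIV. m i / 2 * (v $ i)\<^sup>2)"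
      using mB[of v] by (simp flip: sum_divide_distrib)
    obtain b where b: "\<And>t. q (x + t *\<^sub>R v) = q x + b * t + B v * t\<^sup>2" using line by blast
    have "(\<Sum>i\<in>UNIV. m i / 2 * ((x + t *\<^sub>R v) $ i)\<^sup>2) = (\<Sum>i\<in>UNIV. m i / 2 * (x $ i)\<^sup>2)
        + (\<Sum>i\<in>UNIV. m i * (x $ i) * (v $ i)) * t + (\<Sum>i\<in>UNIV. m i / 2 * (v $ i)\<^sup>2) * t\<^sup>2" for t
      unfolding sum_distrib_right sum.distrib[symmetric]
      by (intro sum.cong) (auto simp: power2_eq_square field_simps)
    then have "Q (x + t *\<^sub>R v) = Q x + (b + (\<Sum>i\<in>UNIV. m i * (x $ i) * (v $ i))) * t
        + (B v + (\<Sum>i\<in>UNIV. m i / 2 * (v $ i)\<^sup>2)) * t\<^sup>2" for t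
      unfolding Q_def b by (simp only: distrib_right add_ac)
    then show "\<exists>b. \<forall>t. Q (x + t *\<^sub>R v) = Q x + b * t + (B v + (\<Sum>i\<in>UNIV. m i / 2 * (v $ i)\<^sup>2)) * t\<^sup>2"
      by blast
  qed
  have "0 \<le> S x + Q x" for x
    using assms(3) by (simp add: nonnegative_polynomial_def pSQ)
  then obtain a c where ac: "\<And>x. a \<bullet> x + c \<le> S x" "\<And>x. 0 \<le> Q x + (a \<bullet> x + c)"
    using convex_on_affine_sandwich[OF S Q] by blast
  \<comment> \<open>The constant term of the affine function is attached to an arbitrary coordinate.\<close>
  define l where "l i = [:if i = undefined then c else 0, a $ i:]" for i :: 'n
  have l: "(\<Sum>i\<in>UNIV. poly (l i) (x $ i)) = a \<bullet> x + c" for x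
    by (simp add: l_def inner_vec_def sum.distrib mult.commute)
  \<comment> \<open>\<open>r\<close> collects all that is added to \<open>q\<close>: a separable
    polynomial of degree at most 2, so the sum stays quadratic.\<close>
  define r where "r i = [:0, 0, m i / 2:] + l i" for i
  have r: "(\<Sum>i\<in>UNIV. poly (r i) (x $ i)) = (\<Sum>i\<in>UNIV. m i / 2 * (x $ i)\<^sup>2) + (a \<bullet> x + c)" for x
    by (simp add: r_def sum.distrib l power2_eq_square mult_ac)
  have "separable_polynomial (\<lambda>x. S x - (a \<bullet> x + c))"
    unfolding separable_polynomial_def S_def
    by (intro exI[of _ "\<lambda>i. s i - [:0, 0, m i / 2:] - l i"] allI)
      (simp add: sum_subtractf l flip: diff_diff_eq)
  moreover have "nonnegative_polynomial (\<lambda>x. S x - (a \<bullet> x + c))"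
    using ac(1) by (simp add: nonnegative_polynomial_def)
  moreover have "quadratic_polynomial (\<lambda>x. Q x + (a \<bullet> x + c))"
  proof -
    have "degree (r i) \<le> 2" for i
      unfolding r_def l_def by (intro degree_add_le) auto
    then have "quadratic_polynomial (\<lambda>x. q x + (\<Sum>i\<in>UNIV. poly (r i) (x $ i)))"
      using q unfolding quadratic_polynomial_def
      by (intro polynomial_of_degree_le_add polynomial_of_degree_le_separable)
    then show ?thesis by (simp add: r Q_def add.assoc)
  qed
  moreover have "nonnegative_polynomial (\<lambda>x. Q x + (a \<bullet> x + c))"
    using ac(2) by (simp add: nonnegative_polynomial_def)
  moreover have "\<forall>x. p x = (S x - (a \<bullet> x + c)) + (Q x + (a \<bullet> x + c))"
    by (simp add: pSQ)
  ultimately show ?thesis by blast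
qed

end
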